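(* The decision problem MATCHING-CUT restricted to $P_5$-free graphs is solvable in polynomial time. That is, there is an algorithm which, given a connected $P_5$-free graph $G$, decides in time polynomial in the size of $G$ whether $G$ has a matching-cut.
   Context: All graphs are finite, simple and undirected. $P_t$ denotes the path with $t$ vertices; a graph is $P_t$-free if it contains no $P_t$ as an induced subgraph. For a connected graph $G$, a set $E' \subset E(G)$ is a cutset if $G - E'$ (the graph obtained from $G$ by removing the edges in $E'$ but not their endpoints) is disconnected. A matching-cut of $G$ is a cutset $E'$ such that no two edges of $E'$ have a vertex in common. MATCHING-CUT is the decision problem: given a connected graph $G$, does $G$ have a matching-cut? *)

theory Defs
  imports "HOL-Computational_Algebra.Polynomial"
begin

section \<open>Finite simple graphs\<close>

type_synonym 'a graph = "'a set \<times> 'a set set"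

abbreviation verts :: "'a graph \<Rightarrow> 'a set" where
  "verts \<equiv> fst"

abbreviation edges :: "'a graph \<Rightarrow> 'a set set" where
  "edges \<equiv> snd"

definition simple_graph :: "'a graph \<Rightarrow> bool" where
  "simple_graph G \<longleftrightarrow> finite (verts G) \<and> (\<forall>e\<in>edges G. e \<subseteq> verts G \<and> card e = 2)"

definition connected_graph :: "'a graph \<Rightarrow> bool" where
  "connected_graph G \<longleftrightarrow> verts G \<noteq> {} \<and>
     (\<forall>u\<in>verts G. \<forall>v\<in>verts G. (u, v) \<in> {(x, y). {x, y} \<in> edges G}\<^sup>*)"

definition induced_subgraph :: "'a graph \<Rightarrow> 'a set \<Rightarrow> 'a graph" where
  "induced_subgraph G S = (S, {e \<in> edges G. e \<subseteq> S})"

definition graph_iso :: "'a graph \<Rightarrow> 'b graph \<Rightarrow> bool" where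
  "graph_iso G H \<longleftrightarrow> (\<exists>f. bij_betw f (verts G) (verts H) \<and>
     (\<forall>u\<in>verts G. \<forall>v\<in>verts G. {u, v} \<in> edges G \<longleftrightarrow> {f u, f v} \<in> edges H))"

definition path_graph :: "nat \<Rightarrow> nat graph" where
  "path_graph t = ({..<t}, {{i, Suc i} |i. Suc i < t})"

definition path_free :: "nat \<Rightarrow> 'a graph \<Rightarrow> bool" where
  "path_free t G \<longleftrightarrow> \<not> (\<exists>S\<subseteq>verts G. graph_iso (path_graph t) (induced_subgraph G S))"

definition cutset :: "'a graph \<Rightarrow> 'a set set \<Rightarrow> bool" where
  "cutset G F \<longleftrightarrow> F \<subseteq> edges G \<and> \<not> connected_graph (verts G, edges G - F)"

definition matching_cut :: "'a graph \<Rightarrow> 'a set set \<Rightarrow> bool" where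
  "matching_cut G F \<longleftrightarrow> cutset G F \<and> (\<forall>e\<in>F. \<forall>f\<in>F. e \<noteq> f \<longrightarrow> e \<inter> f = {})"

definition has_matching_cut :: "'a graph \<Rightarrow> bool" where
  "has_matching_cut G \<longleftrightarrow> (\<exists>F. matching_cut G F)"


section \<open>Polynomial time\<close>

text \<open>
  The machine model is a random access machine, programmed in a structured while language. The
  memory consists of arrays of natural numbers with unbounded index range; a fixed program
  mentions only finitely many arrays, and cell 0 of an array serves as a scalar register.
  Arithmetic is restricted to addition and truncated subtraction, so that the
  number of bits of the values computed by a fixed program grows at most linearly with the number
  of steps, and unit cost is polynomially related to the running time of Turing machines.
\<close>

type_synonym state = "nat \<Rightarrow> nat \<Rightarrow> nat"

datatype exp =
    Const nat
  | Cell nat exp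
  | Plus exp exp
  | Minus exp exp

primrec exp_val :: "exp \<Rightarrow> state \<Rightarrow> nat" where
  "exp_val (Const n) s = n"
| "exp_val (Cell a e) s = s a (exp_val e s)"
| "exp_val (Plus e1 e2) s = exp_val e1 s + exp_val e2 s"
| "exp_val (Minus e1 e2) s = exp_val e1 s - exp_val e2 s"

primrec exp_cost :: "exp \<Rightarrow> nat" where
  "exp_cost (Const n) = 1"
| "exp_cost (Cell a e) = 1 + exp_cost e"
| "exp_cost (Plus e1 e2) = 1 + exp_cost e1 + exp_cost e2"
| "exp_cost (Minus e1 e2) = 1 + exp_cost e1 + exp_cost e2"

text \<open>
  \<open>Assign a e1 e2\<close> stores the value of \<open>e2\<close> in the cell of array \<open>a\<close> whose index is the
  value of \<open>e1\<close>. A test succeeds iff its value is nonzero.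
\<close>

datatype com =
    Skip
  | Assign nat exp exp
  | Seq com com
  | Cond exp com com
  | While exp com

text \<open>\<open>exec c s t s'\<close>: started in \<open>s\<close>, the program \<open>c\<close> halts in \<open>s'\<close> after \<open>t\<close> steps.\<close>

inductive exec :: "com \<Rightarrow> state \<Rightarrow> nat \<Rightarrow> state \<Rightarrow> bool" where
  Skip: "exec Skip s 1 s"
| Assign: "exec (Assign a e1 e2) s (1 + exp_cost e1 + exp_cost e2)
             (s(a := (s a)(exp_val e1 s := exp_val e2 s)))"
| Seq: "\<lbrakk>exec c1 s t1 s'; exec c2 s' t2 s''\<rbrakk> \<Longrightarrow> exec (Seq c1 c2) s (t1 + t2) s''"
| CondTrue: "\<lbrakk>exp_val e s \<noteq> 0; exec c1 s t s'\<rbrakk>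
             \<Longrightarrow> exec (Cond e c1 c2) s (1 + exp_cost e + t) s'"
| CondFalse: "\<lbrakk>exp_val e s = 0; exec c2 s t s'\<rbrakk>
             \<Longrightarrow> exec (Cond e c1 c2) s (1 + exp_cost e + t) s'"
| WhileFalse: "exp_val e s = 0 \<Longrightarrow> exec (While e c) s (1 + exp_cost e) s"
| WhileTrue: "\<lbrakk>exp_val e s \<noteq> 0; exec c s t1 s'; exec (While e c) s' t2 s''\<rbrakk>
             \<Longrightarrow> exec (While e c) s (1 + exp_cost e + t1 + t2) s''"

inductive_cases exec_SkipE: "exec Skip s t s'"
inductive_cases exec_AssignE: "exec (Assign a e1 e2) s t s'"
inductive_cases exec_SeqE: "exec (Seq c1 c2) s t s'"
inductive_cases exec_CondE: "exec (Cond e c1 c2) s t s'"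
inductive_cases exec_WhileE: "exec (While e c) s t s'"

lemma exec_deterministic:
  "exec c s t s' \<Longrightarrow> exec c s u s'' \<Longrightarrow> t = u \<and> s' = s''"
proof (induction arbitrary: u s'' rule: exec.induct)
  case Skip
  then show ?case by (elim exec_SkipE) simp
next
  case Assign
  then show ?case by (elim exec_AssignE) simp
next
  case (Seq c1 s t1 s' c2 t2 s2)
  from Seq.prems obtain u1 r u2 where r: "u = u1 + u2" "exec c1 s u1 r" "exec c2 r u2 s''"
    by (rule exec_SeqE)
  then have "exec c2 s' u2 s''"
    using Seq.IH(1)[OF r(2)] by simp
  from Seq.IH(1)[OF r(2)] Seq.IH(2)[OF this] r(1) show ?case by simp
next
  case (CondTrue e s c1 t s' c2)
  from CondTrue.prems CondTrue.hyps(1) obtain v where v: "u = 1 + exp_cost e + v" "exec c1 s v s''"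
    by - (erule exec_CondE, simp_all)
  with CondTrue.IH[OF v(2)] show ?case by simp
next
  case (CondFalse e s c2 t s' c1)
  from CondFalse.prems CondFalse.hyps(1) obtain v where v: "u = 1 + exp_cost e + v" "exec c2 s v s''"
    by - (erule exec_CondE, simp_all)
  with CondFalse.IH[OF v(2)] show ?case by simp
next
  case (WhileFalse e s c)
  from WhileFalse.prems show ?case
    by (rule exec_WhileE) (use WhileFalse.hyps in auto)
next
  case (WhileTrue e s c t1 s' t2 s2)
  from WhileTrue.prems WhileTrue.hyps(1) obtain u1 r u2
    where r: "u = 1 + exp_cost e + u1 + u2" "exec c s u1 r" "exec (While e c) r u2 s''"
    by - (erule exec_WhileE, simp_all)
  then have "exec (While e c) s' u2 s''"
    using WhileTrue.IH(1)[OF r(2)] by simp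
  from WhileTrue.IH(1)[OF r(2)] WhileTrue.IH(2)[OF this] r(1) show ?case by simp
qed

text \<open>
  The input is a bit string: its length is stored in cell 0 of array 0, its bits in array 1, and
  all other cells are 0. The answer is returned in cell 0 of array 0.
\<close>

definition input_state :: "bool list \<Rightarrow> state" where
  "input_state w = (\<lambda>a i.
     if a = 0 \<and> i = 0 then length w
     else if a = 1 \<and> i < length w then of_bool (w ! i)
     else 0)"

text \<open>
  The problem \<open>P\<close>, restricted to the instances in \<open>X\<close>, is solvable in time polynomial in the
  length of the encoding \<open>enc\<close>. A single program and a single polynomial serve all instances;
  nothing is required of the program on other inputs.
\<close>

definition poly_time_solvable_on :: "('i \<Rightarrow> bool list) \<Rightarrow> 'i set \<Rightarrow> ('i \<Rightarrow> bool) \<Rightarrow> bool" where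
  "poly_time_solvable_on enc X P \<longleftrightarrow>
     (\<exists>(c :: com) (p :: nat poly). \<forall>x\<in>X. \<exists>t s.
        exec c (input_state (enc x)) t s \<and>
        t \<le> poly p (length (enc x)) \<and>
        s 0 0 = (if P x then 1 else 0))"

text \<open>
  An input graph has vertex set \<open>{..<n}\<close> and is given by its adjacency matrix, row by row; the
  encoding has length \<open>n * n\<close>.
\<close>

definition adjacency_matrix :: "nat graph \<Rightarrow> bool list" where
  "adjacency_matrix G =
     [{i, j} \<in> edges G. i \<leftarrow> [0..<card (verts G)], j \<leftarrow> [0..<card (verts G)]]"

definition graph_instances :: "nat graph set" where
  "graph_instances = {G. simple_graph G \<and> (\<exists>n. verts G = {..<n})}"

end

theory Submission
  imports Defs
begin

text \<open>
  A matching cut is a red-blue colouring in which every vertex has at most one neighbour of the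
  other colour. On \<open>P\<^sub>5\<close>-free graphs its existence is first-order definable. Let \<open>u v\<close> be an edge
  with \<open>u\<close> red and \<open>v\<close> blue; then the other neighbours of \<open>u\<close> are red and those of \<open>v\<close> are blue, and
  adjacent vertices further away have the same neighbours in these two sides. Hence the remaining
  colours are forced or can be normalised, except for some vertices with a single neighbour in each
  side. By \<open>P\<^sub>5\<close>-freeness any two of these share one of their two neighbours, so they all share the
  red one or all share the blue one; in the first case at most one of them is blue. Guessing \<open>u\<close>,
  \<open>v\<close> and this vertex thus determines a colouring by an explicit formula, and first-order formulas
  are evaluated in polynomial time by nested loops.
\<close>

section \<open>Matching cuts as colourings\<close>

text \<open>\<open>B w\<close> says that \<open>w\<close> is blue. That both colours occur is
  expressed separately, by a red-blue edge.\<close>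

definition cut_colouring :: "('a \<Rightarrow> 'a \<Rightarrow> bool) \<Rightarrow> ('a \<Rightarrow> bool) \<Rightarrow> bool" where
  "cut_colouring E B \<longleftrightarrow>
     (\<forall>w y z. E w y \<and> E w z \<and> B y \<noteq> B w \<and> B z \<noteq> B w \<longrightarrow> y = z)"

lemma cut_colouringD:
  "\<lbrakk>cut_colouring E B; E w y; E w z; B y \<noteq> B w; B z \<noteq> B w\<rbrakk> \<Longrightarrow> y = z"
  unfolding cut_colouring_def by blast

lemma cut_colouring_compl: "cut_colouring E (\<lambda>w. \<not> B w) \<longleftrightarrow> cut_colouring E B"
  unfolding cut_colouring_def by simp

lemma rtrancl_crossing:
  assumes "(x, y) \<in> r\<^sup>*" "P x" "\<not> P y"
  obtains a b where "(a, b) \<in> r" "P a" "\<not> P b"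
  using assms by (induction rule: rtrancl_induct) blast+

text \<open>From a cut \<open>F\<close>, colour red what is reachable from \<open>p\<close> without
  \<open>F\<close>; from a colouring, cut all bichromatic edges. Connectedness yields an edge
  \<open>u v\<close> with a red and a blue end.\<close>

lemma has_matching_cut_iff_colouring:
  assumes "simple_graph G" "connected_graph G"
  defines "E \<equiv> \<lambda>x y. {x, y} \<in> edges G"
  shows "has_matching_cut G \<longleftrightarrow> (\<exists>u v B. E u v \<and> \<not> B u \<and> B v \<and> cut_colouring E B)"
proof
  have sym: "E y x" if "E x y" for x y
    using that unfolding E_def by (simp add: insert_commute)
  {
    assume "has_matching_cut G"
    then obtain F where "matching_cut G F"
      unfolding has_matching_cut_def ..
    then have F: "F \<subseteq> edges G" "\<not> connected_graph (verts G, edges G - F)"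
      and disj: "\<And>e f. e \<in> F \<Longrightarrow> f \<in> F \<Longrightarrow> e \<noteq> f \<Longrightarrow> e \<inter> f = {}"
      unfolding matching_cut_def cutset_def by simp_all
    define r where "r = {(x, y). {x, y} \<in> edges G - F}"
    obtain p q where pq: "p \<in> verts G" "q \<in> verts G" "(p, q) \<notin> r\<^sup>*"
      using F(2) assms(2) unfolding connected_graph_def r_def by auto
    define B where "B y \<longleftrightarrow> (p, y) \<notin> r\<^sup>*" for y
    have cross: "{x, y} \<in> F" if "E x y" "B x \<noteq> B y" for x y
    proof (rule ccontr)
      assume "{x, y} \<notin> F"
      with that(1) have "(x, y) \<in> r" "(y, x) \<in> r"
        unfolding r_def E_def by (auto simp: insert_commute)
      with that(2) show False
        unfolding B_def by (meson rtrancl.rtrancl_into_rtrancl)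
    qed
    have "cut_colouring E B"
      unfolding cut_colouring_def
    proof (intro allI impI, elim conjE, rule ccontr)
      fix w y z
      assume a: "E w y" "E w z" "B y \<noteq> B w" "B z \<noteq> B w" "y \<noteq> z"
      then have "{w, y} \<in> F" "{w, z} \<in> F"
        using cross by auto
      moreover have "{w, y} \<noteq> {w, z}"
        using a(5) by (auto simp: doubleton_eq_iff)
      ultimately show False
        using disj by blast
    qed
    moreover have "\<not> B p" "B q"
      using pq unfolding B_def by auto
    moreover obtain u v where "E u v" "\<not> B u" "B v"
    proof -
      have "(p, q) \<in> {(x, y). {x, y} \<in> edges G}\<^sup>*"
        using assms(2) pq unfolding connected_graph_def by blast
      then show ?thesis
        by (rule rtrancl_crossing[where P = "\<lambda>x. \<not> B x"])
          (use calculation that in \<open>auto simp: E_def\<close>)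
    qed
    ultimately show "\<exists>u v B. E u v \<and> \<not> B u \<and> B v \<and> cut_colouring E B"
      by blast
  }
  {
    assume "\<exists>u v B. E u v \<and> \<not> B u \<and> B v \<and> cut_colouring E B"
    then obtain u v B where B: "E u v" "\<not> B u" "B v" "cut_colouring E B"
      by blast
    define F where "F = {{x, y} |x y. E x y \<and> \<not> B x \<and> B y}"
    have uv: "u \<in> verts G" "v \<in> verts G"
      using B(1) assms(1) unfolding E_def simple_graph_def by auto
    have "(u, v) \<notin> {(x, y). {x, y} \<in> edges G - F}\<^sup>*"
    proof
      assume "(u, v) \<in> {(x, y). {x, y} \<in> edges G - F}\<^sup>*"
      then obtain a b where "{a, b} \<in> edges G - F" "\<not> B a" "\<not> \<not> B b"
        using B(2,3) by (elim rtrancl_crossing[where P = "\<lambda>x. \<not> B x"]) auto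
      then show False
        unfolding F_def E_def by blast
    qed
    then have "\<not> connected_graph (verts G, edges G - F)"
      using uv unfolding connected_graph_def by auto
    moreover have "F \<subseteq> edges G"
      unfolding F_def E_def by blast
    moreover have "e \<inter> f = {}" if e_f: "e \<in> F" "f \<in> F" "e \<noteq> f" for e f
    proof -
      \<comment> \<open>The red ends \<open>a\<close>, \<open>c\<close> and the blue ends
        \<open>b\<close>, \<open>d\<close> can only coincide within their colour, and this would
        give a vertex two neighbours of the other colour.\<close>
      obtain a b c d where ef: "e = {a, b}" "E a b" "\<not> B a" "B b" "f = {c, d}" "E c d" "\<not> B c" "B d"
        using e_f(1,2) unfolding F_def by blast
      have "a \<noteq> c"
        using cut_colouringD[OF B(4), of a b d] ef e_f(3) by auto
      moreover have "b \<noteq> d"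
        using cut_colouringD[OF B(4), of b a c] sym ef e_f(3) by auto
      ultimately show ?thesis
        using ef by auto
    qed
    ultimately show "has_matching_cut G"
      unfolding has_matching_cut_def matching_cut_def cutset_def by blast
  }
qed

section \<open>The structure of colourings of path-free graphs\<close>

text \<open>With \<open>u\<close> red and \<open>v\<close> blue, these vertices are forced to be
  red; exchanging \<open>u\<close> and \<open>v\<close> gives those forced to be blue.\<close>

definition side :: "('a \<Rightarrow> 'a \<Rightarrow> bool) \<Rightarrow> 'a \<Rightarrow> 'a \<Rightarrow> 'a \<Rightarrow> bool" where
  "side E u v w \<longleftrightarrow> w = u \<or> E w u \<and> w \<noteq> v"

text \<open>The alternatives for a vertex outside both sides: two blue-side neighbours force blue;
  without a red-side neighbour, blue is a normalised choice; a blue-side neighbour that already has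
  a red neighbour forces blue; \<open>x\<close> is the guessed exception.\<close>

definition blue :: "('a \<Rightarrow> 'a \<Rightarrow> bool) \<Rightarrow> 'a \<Rightarrow> 'a \<Rightarrow> 'a \<Rightarrow> 'a \<Rightarrow> bool" where
  "blue E u v x w \<longleftrightarrow> side E v u w \<or> \<not> side E u v w \<and>
     ((\<exists>y z. y \<noteq> z \<and> E w y \<and> E w z \<and> side E v u y \<and> side E v u z) \<or>
      \<not> (\<exists>y. E w y \<and> side E u v y) \<or>
      (\<exists>y z. E w y \<and> side E v u y \<and> E y z \<and> side E u v z) \<or>
      w = x)"

text \<open>
  The vertices, with their neighbours in the two sides, whose colour is not forced by a
  red-blue edge \<open>u v\<close>.
\<close>

definition undecided :: "('a \<Rightarrow> 'a \<Rightarrow> bool) \<Rightarrow> 'a \<Rightarrow> 'a \<Rightarrow> 'a \<Rightarrow> 'a \<Rightarrow> 'a \<Rightarrow> bool" where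
  "undecided E u v w a c \<longleftrightarrow> \<not> side E u v w \<and> \<not> side E v u w \<and>
     E w a \<and> side E u v a \<and> E w c \<and> side E v u c \<and>
     (\<forall>y. E w y \<and> side E u v y \<longrightarrow> y = a) \<and> (\<forall>y. E w y \<and> side E v u y \<longrightarrow> y = c) \<and>
     \<not> (\<exists>y. E a y \<and> side E v u y) \<and> \<not> (\<exists>y. E c y \<and> side E u v y)"

lemma undecided_swap: "undecided E u v w a c \<longleftrightarrow> undecided E v u w c a"
  unfolding undecided_def by blast

text \<open>In \<open>no_P5\<close> a chordless walk automatically has five distinct vertices, since
  a coincidence would produce a chord or a loop.\<close>

locale P5_free_adjacency =
  fixes E :: "'a \<Rightarrow> 'a \<Rightarrow> bool"
  assumes sym: "E x y \<Longrightarrow> E y x"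
    and irrefl: "\<not> E x x"
    and no_P5: "\<lbrakk>E a b; E b c; E c d; E d e\<rbrakk> \<Longrightarrow> E a c \<or> E a d \<or> E a e \<or> E b d \<or> E b e \<or> E c e"
begin

text \<open>\<open>v\<close> is already the one blue neighbour of \<open>u\<close>.\<close>

lemma side_red:
  assumes "cut_colouring E B" "E u v" "\<not> B u" "B v" "side E u v w"
  shows "\<not> B w"
  using cut_colouringD[OF assms(1), of u v w] assms sym unfolding side_def by blast

lemma side_blue:
  assumes "cut_colouring E B" "E u v" "\<not> B u" "B v" "side E v u w"
  shows "B w"
  using side_red[of "\<lambda>w. \<not> B w" v u w] assms sym by (simp add: cut_colouring_compl)

text \<open>Otherwise \<open>w' w z u v\<close> is an induced path on five vertices.\<close>

lemma outer_adj:
  assumes "E u v" "\<And>z. \<not> (side E u v z \<and> side E v u z)"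
    and "\<not> side E u v w" "\<not> side E v u w" "\<not> side E u v w'" "\<not> side E v u w'"
    and "E w w'" "E w z" "side E u v z"
  shows "E w' z"
proof -
  have "z \<noteq> u" "E z u" "\<not> E z v"
    using assms sym irrefl unfolding side_def by blast+
  moreover have "\<not> E w u" "\<not> E w v" "\<not> E w' u" "\<not> E w' v"
    using assms sym irrefl unfolding side_def by blast+
  ultimately show ?thesis
    using no_P5[of w' w z u v] assms sym by blast
qed

text \<open>If both neighbours differ, \<open>w a u a' w'\<close> forces an edge
  \<open>a a'\<close>, and then \<open>w a a' w' c'\<close> is an induced path.\<close>

lemma undecided_share:
  assumes uv: "E u v" and disj: "\<And>z. \<not> (side E u v z \<and> side E v u z)"
    and U: "undecided E u v w a c" and U': "undecided E u v w' a' c'"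
  shows "a = a' \<or> c = c'"
proof (rule ccontr)
  assume "\<not> (a = a' \<or> c = c')"
  then have ne: "a \<noteq> a'" "c \<noteq> c'" by auto
  note D = U[unfolded undecided_def] and D' = U'[unfolded undecided_def]
  have n1: "\<not> E w a'" "\<not> E w' a" "\<not> E w c'" "\<not> E a c'" "\<not> E a' c'"
    using D D' ne by blast+
  \<comment> \<open>An edge \<open>w w'\<close> would make \<open>a\<close> a second red-side
    neighbour of \<open>w'\<close>.\<close>
  have n2: "\<not> E w w'"
    using outer_adj[OF uv disj, of w w' a] D D' n1 by blast
  have n3: "\<not> E w u" "\<not> E w' u" "E a u" "E a' u"
    using D D' irrefl sym unfolding side_def by blast+
  have "E a a'"
    using no_P5[of w a u a' w'] D D' n1 n2 n3 sym by blast
  then show False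
    using no_P5[of w a a' w' c'] D D' n1 n2 sym by blast
qed

text \<open>The pairs \<open>(a, c)\<close> are pairwise intersecting edges of a bipartite graph,
  and these form a star.\<close>

lemma undecided_star:
  assumes "E u v" "\<And>z. \<not> (side E u v z \<and> side E v u z)"
  shows "(\<exists>z. \<forall>w a c. undecided E u v w a c \<longrightarrow> a = z) \<or>
         (\<exists>z. \<forall>w a c. undecided E u v w a c \<longrightarrow> c = z)"
  using undecided_share[OF assms] by metis

text \<open>\<open>B\<close> is first normalised to \<open>B'\<close>. The undecided vertices that
  \<open>B\<close> colours blue are neighbours of the red vertex \<open>z\<close>, so there is at
  most one; taking it as \<open>x\<close> makes the formula equal to \<open>B'\<close>.\<close>

lemma blue_cut_colouring:
  assumes B: "cut_colouring E B" and uv: "E u v" "\<not> B u" "B v"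
    and star: "\<And>w a c. undecided E u v w a c \<Longrightarrow> a = z"
  shows "\<exists>x. (x = v \<or> (\<exists>y. E x y)) \<and> cut_colouring E (blue E u v x)"
proof -
  let ?A = "side E u v" and ?C = "side E v u"
  note A = side_red[OF B uv] and C = side_blue[OF B uv]
  have disj: "\<not> (?A y \<and> ?C y)" for y
    using A C by blast
  have disj': "\<not> (?C y \<and> ?A y)" for y
    using A C by blast
  define nA where "nA w \<longleftrightarrow> (\<exists>y. E w y \<and> ?A y)" for w
  define nC where "nC w \<longleftrightarrow> (\<exists>y. E w y \<and> ?C y)" for w
  \<comment> \<open>A component outside both sides that sees at most one of them takes the colour of that side.\<close>
  define B' where "B' w \<longleftrightarrow> ?C w \<or> \<not> ?A w \<and> (nA w \<longrightarrow> nC w \<and> B w)" for w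
  have same: "nA w \<longleftrightarrow> nA y" "nC w \<longleftrightarrow> nC y"
    if "E w y" "\<not> ?A w" "\<not> ?C w" "\<not> ?A y" "\<not> ?C y" for w y
    using that outer_adj[OF uv(1) disj] outer_adj[OF sym[OF uv(1)] disj'] sym
    unfolding nA_def nC_def by meson+
  \<comment> \<open>An edge that is bichromatic under \<open>B'\<close> has the same colours under
    \<open>B\<close>, so \<open>B'\<close> inherits the defining condition.\<close>
  have opp: "B' w \<noteq> B' y \<Longrightarrow> B' w = B w \<and> B' y = B y" if "E w y" for w y
    using that same[of w y] A[of w] A[of y] C[of w] C[of y] disj[of w] disj[of y] sym[OF that]
    unfolding B'_def nA_def nC_def by metis
  have B': "cut_colouring E B'"
    unfolding cut_colouring_def using opp cut_colouringD[OF B] by metis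
  define U where "U w \<longleftrightarrow> B w \<and> (\<exists>a c. undecided E u v w a c)" for w
  have U_unique: "w = w'" if UU: "U w" "U w'" for w w'
  proof -
    obtain a c a' c' where "undecided E u v w a c" "undecided E u v w' a' c'"
      using UU unfolding U_def by blast
    moreover from this have "a = z" "a' = z"
      using star by blast+
    ultimately have "E w z" "E w' z" "side E u v z"
      unfolding undecided_def by blast+
    then have "E z w" "E z w'" "\<not> B z"
      using A sym by blast+
    then show ?thesis
      using cut_colouringD[OF B, of z w w'] UU unfolding U_def by blast
  qed
  \<comment> \<open>The default \<open>v\<close> is harmless: it lies in a side, so the clause
    \<open>w = x\<close> affects no vertex outside the sides.\<close>
  define x where "x = (if \<exists>w. U w then SOME w. U w else v)"
  have x_cases: "x = v \<or> U x"
    unfolding x_def by (auto intro: someI)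
  have x_eq: "w = x" if "U w" for w
    using U_unique[of w x] that someI[of U w] unfolding x_def by auto
  have "blue E u v x w = B' w" for w
  proof (cases "?A w \<or> ?C w")
    case True
    then show ?thesis
      using disj[of w] unfolding blue_def B'_def by auto
  next
    case False
    show ?thesis
    proof
      assume b: "blue E u v x w"
      show "B' w"
      proof (cases "nA w")
        case nA: True
        consider y y' where "y \<noteq> y'" "E w y" "E w y'" "?C y" "?C y'"
          | y a where "E w y" "?C y" "E y a" "?A a" | "w = x"
          using b False nA unfolding blue_def nA_def by blast
        then have "nC w \<and> B w"
        proof cases
          case 1
          then show ?thesis
            using cut_colouringD[OF B, of w y y'] C unfolding nC_def by blast
        next
          case 2
          then show ?thesis
            using cut_colouringD[OF B, of y a w] A[of a] C[of y] False sym
            unfolding nC_def by blast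
        next
          case 3
          then have "U w"
            using x_cases False unfolding side_def by blast
          then show ?thesis
            unfolding U_def undecided_def nC_def by blast
        qed
        then show ?thesis
          using False unfolding B'_def by blast
      qed (use False in \<open>auto simp: B'_def\<close>)
    next
      assume b: "B' w"
      show "blue E u v x w"
      proof (rule ccontr)
        \<comment> \<open>A vertex that is blue under \<open>B'\<close> but covered by none of the
          other clauses is undecided and blue, hence equal to \<open>x\<close>, which the last
          clause covers.\<close>
        assume nb: "\<not> blue E u v x w"
        then have F: "\<And>y y'. \<lbrakk>E w y; E w y'; ?C y; ?C y'\<rbrakk> \<Longrightarrow> y = y'" "nA w"
          "\<And>y a. \<lbrakk>E w y; ?C y; E y a; ?A a\<rbrakk> \<Longrightarrow> False" "w \<noteq> x"
          using False unfolding blue_def nA_def by blast+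
        then have Bw: "B w" "nC w"
          using b False unfolding B'_def by blast+
        obtain a c where ac: "E w a" "?A a" "E w c" "?C c"
          using F(2) Bw(2) unfolding nA_def nC_def by blast
        have "y = a" if "E w y" "?A y" for y
          using cut_colouringD[OF B, of w y a] that ac A Bw by blast
        moreover have "\<not> (E a y \<and> ?C y)" for y
          using cut_colouringD[OF B, of a y w] ac A[of a] C[of y] Bw False sym by blast
        ultimately have "undecided E u v w a c"
          using ac F False unfolding undecided_def by blast
        then show False
          using x_eq[of w] Bw F(4) unfolding U_def by blast
      qed
    qed
  qed
  then have "blue E u v x = B'" ..
  with B' have "cut_colouring E (blue E u v x)"
    by simp
  moreover have "x = v \<or> (\<exists>y. E x y)"
    using x_cases unfolding U_def undecided_def by blast
  ultimately show ?thesis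
    by blast
qed

text \<open>If the undecided vertices share their blue neighbour instead, the colours and the ends
  of \<open>u v\<close> are exchanged, so one formula suffices. The conjunct
  \<open>\<exists>y. E x y\<close> later puts \<open>x\<close> in the range of a bounded
  quantifier.\<close>

lemma ex_cut_colouring_iff_blue:
  "(\<exists>u v B. E u v \<and> \<not> B u \<and> B v \<and> cut_colouring E B) \<longleftrightarrow>
   (\<exists>u v x. E u v \<and> (\<exists>y. E x y) \<and> cut_colouring E (blue E u v x))"
proof
  assume "\<exists>u v B. E u v \<and> \<not> B u \<and> B v \<and> cut_colouring E B"
  then obtain u v B where B: "E u v" "\<not> B u" "B v" "cut_colouring E B"
    by blast
  have disj: "\<not> (side E u v z \<and> side E v u z)" for z
    using side_red[OF B(4,1-3)] side_blue[OF B(4,1-3)] by blast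
  from undecided_star[OF B(1) disj]
  show "\<exists>u v x. E u v \<and> (\<exists>y. E x y) \<and> cut_colouring E (blue E u v x)"
  proof
    assume "\<exists>z. \<forall>w a c. undecided E u v w a c \<longrightarrow> a = z"
    then show ?thesis
      using blue_cut_colouring[OF B(4,1-3)] B(1) sym by blast
  next
    assume "\<exists>z. \<forall>w a c. undecided E u v w a c \<longrightarrow> c = z"
    then obtain z where "\<And>w a c. undecided E v u w a c \<Longrightarrow> a = z"
      using undecided_swap by metis
    then have "\<exists>x. (x = u \<or> (\<exists>y. E x y)) \<and> cut_colouring E (blue E v u x)"
      using B sym by (intro blue_cut_colouring[of "\<lambda>w. \<not> B w" v u z]) (auto simp: cut_colouring_compl)
    then show ?thesis
      using B(1) sym by blast
  qed
next
  assume "\<exists>u v x. E u v \<and> (\<exists>y. E x y) \<and> cut_colouring E (blue E u v x)"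
  then obtain u v x where uvx: "E u v" "cut_colouring E (blue E u v x)"
    by blast
  then have "\<not> blue E u v x u" "blue E u v x v"
    using irrefl unfolding blue_def side_def by auto
  with uvx show "\<exists>u v B. E u v \<and> \<not> B u \<and> B v \<and> cut_colouring E B"
    by blast
qed

end

text \<open>Listing a chordless walk by \<open>f\<close> gives an isomorphism from
  \<open>path_graph 5\<close> to the subgraph induced on its vertices.\<close>

lemma path_free_5_no_P5:
  assumes "simple_graph G" "path_free 5 G"
  defines "E \<equiv> \<lambda>x y. {x, y} \<in> edges G"
  shows "P5_free_adjacency E"
proof
  show sym: "E y x" if "E x y" for x y
    using that unfolding E_def by (simp add: insert_commute)
  show irrefl: "\<not> E x x" for x
    using assms(1) unfolding E_def simple_graph_def by fastforce
  fix a b c d e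
  assume adj: "E a b" "E b c" "E c d" "E d e"
  show "E a c \<or> E a d \<or> E a e \<or> E b d \<or> E b e \<or> E c e"
  proof (rule ccontr)
    assume "\<not> ?thesis"
    then have n: "\<not> E a c" "\<not> E a d" "\<not> E a e" "\<not> E b d" "\<not> E b e" "\<not> E c e"
      by auto
    have dist: "distinct [a, b, c, d, e]"
      using adj n irrefl sym by auto
    define S where "S = {a, b, c, d, e}"
    define f where "f = (!) [a, b, c, d, e]"
    have lt5: "{..<5::nat} = {0, 1, 2, 3, 4}"
      by auto
    have f: "f 0 = a" "f 1 = b" "f (Suc 0) = b" "f 2 = c" "f 3 = d" "f 4 = e"
      unfolding f_def by (simp_all add: numeral_eq_Suc)
    have "bij_betw f {..<5} S"
      using dist unfolding bij_betw_def lt5 S_def by (auto simp: f inj_on_def)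
    moreover have path: "{i, j} \<in> edges (path_graph 5) \<longleftrightarrow> i < 5 \<and> j < 5 \<and> (j = Suc i \<or> i = Suc j)" for i j
      unfolding path_graph_def by (auto simp: doubleton_eq_iff)
    moreover have "{f i, f j} \<in> edges (induced_subgraph G S) \<longleftrightarrow> E (f i) (f j)"
      if "i < 5" "j < 5" for i j
    proof -
      have "f i \<in> S" "f j \<in> S"
        using that bij_betwE[OF \<open>bij_betw f {..<5} S\<close>] by auto
      then show ?thesis
        unfolding induced_subgraph_def E_def by auto
    qed
    moreover have "E (f i) (f j) \<longleftrightarrow> j = Suc i \<or> i = Suc j" if "i < 5" "j < 5" for i j
    proof -
      have "i \<in> {0, 1, 2, 3, 4}" "j \<in> {0, 1, 2, 3, 4}"
        using that by auto
      then show ?thesis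
        using adj n sym irrefl by (elim insertE) (auto simp: f)
    qed
    ultimately have "graph_iso (path_graph 5) (induced_subgraph G S)"
      unfolding graph_iso_def by (intro exI[of _ f])
        (auto simp: path_graph_def induced_subgraph_def)
    moreover have "S \<subseteq> verts G"
      using adj assms(1) unfolding S_def E_def simple_graph_def by auto
    ultimately show False
      using assms(2) unfolding path_free_def by blast
  qed
qed

section \<open>Model checking first-order formulas in polynomial time\<close>

text \<open>Variables are de Bruijn levels: a quantifier at depth \<open>d\<close> binds the variable \<open>d\<close>.\<close>

datatype fm = Adj nat nat | Eq nat nat | Neg fm | Conj fm fm | Exi fm

primrec sat :: "nat \<Rightarrow> (nat \<Rightarrow> nat \<Rightarrow> bool) \<Rightarrow> fm \<Rightarrow> nat \<Rightarrow> (nat \<Rightarrow> nat) \<Rightarrow> bool" where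
  "sat n E (Adj i j) d \<rho> \<longleftrightarrow> E (\<rho> i) (\<rho> j)"
| "sat n E (Eq i j) d \<rho> \<longleftrightarrow> \<rho> i = \<rho> j"
| "sat n E (Neg \<phi>) d \<rho> \<longleftrightarrow> \<not> sat n E \<phi> d \<rho>"
| "sat n E (Conj \<phi> \<psi>) d \<rho> \<longleftrightarrow> sat n E \<phi> d \<rho> \<and> sat n E \<psi> d \<rho>"
| "sat n E (Exi \<phi>) d \<rho> \<longleftrightarrow> (\<exists>x<n. sat n E \<phi> (Suc d) (\<rho>(d := x)))"

primrec wf_fm :: "fm \<Rightarrow> nat \<Rightarrow> bool" where
  "wf_fm (Adj i j) d \<longleftrightarrow> i < d \<and> j < d"
| "wf_fm (Eq i j) d \<longleftrightarrow> i < d \<and> j < d"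
| "wf_fm (Neg \<phi>) d \<longleftrightarrow> wf_fm \<phi> d"
| "wf_fm (Conj \<phi> \<psi>) d \<longleftrightarrow> wf_fm \<phi> d \<and> wf_fm \<psi> d"
| "wf_fm (Exi \<phi>) d \<longleftrightarrow> wf_fm \<phi> (Suc d)"

abbreviation reg :: "nat \<Rightarrow> exp" where
  "reg a \<equiv> Cell a (Const 0)"

abbreviation set_reg :: "nat \<Rightarrow> exp \<Rightarrow> com" where
  "set_reg a e \<equiv> Assign a (Const 0) e"

text \<open>
  Register 0 receives the truth value and register 2 contains the number \<open>n\<close> of vertices. For
  the variable \<open>i\<close>, register \<open>3 * i + 3\<close> contains its value \<open>v\<close>, register \<open>3 * i + 4\<close> the product
  \<open>v * n\<close>, which is the beginning of row \<open>v\<close> of the adjacency matrix, and register \<open>3 * i + 5\<close>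
  records whether a witness for the quantifier has been found.
\<close>

abbreviation exi_body :: "com \<Rightarrow> nat \<Rightarrow> com" where
  "exi_body c d \<equiv>
     Seq c (Seq (Cond (reg 0) (set_reg (3 * d + 5) (Const 1)) Skip)
       (Seq (set_reg (3 * d + 3) (Plus (reg (3 * d + 3)) (Const 1)))
         (set_reg (3 * d + 4) (Plus (reg (3 * d + 4)) (reg 2)))))"

text \<open>Subtraction is truncated, so the guard is nonzero exactly while the value is below
  \<open>n\<close>.\<close>

abbreviation exi_loop :: "com \<Rightarrow> nat \<Rightarrow> com" where
  "exi_loop c d \<equiv> While (Minus (reg 2) (reg (3 * d + 3))) (exi_body c d)"

text \<open>Without multiplication, a matrix entry is addressed by adding the column to the stored
  start of the row. Equality means that both truncated differences vanish. If the first conjunct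
  fails, register 0 already holds the answer 0.\<close>

primrec compile :: "fm \<Rightarrow> nat \<Rightarrow> com" where
  "compile (Adj i j) d = set_reg 0 (Cell 1 (Plus (reg (3 * i + 4)) (reg (3 * j + 3))))"
| "compile (Eq i j) d =
     set_reg 0 (Minus (Const 1) (Plus (Minus (reg (3 * i + 3)) (reg (3 * j + 3)))
       (Minus (reg (3 * j + 3)) (reg (3 * i + 3)))))"
| "compile (Neg \<phi>) d = Seq (compile \<phi> d) (set_reg 0 (Minus (Const 1) (reg 0)))"
| "compile (Conj \<phi> \<psi>) d = Seq (compile \<phi> d) (Cond (reg 0) (compile \<psi> d) Skip)"
| "compile (Exi \<phi>) d =
     Seq (set_reg (3 * d + 3) (Const 0)) (Seq (set_reg (3 * d + 4) (Const 0))
       (Seq (set_reg (3 * d + 5) (Const 0)) (Seq (exi_loop (compile \<phi> (Suc d)) d)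
         (set_reg 0 (reg (3 * d + 5))))))"

text \<open>Each quantifier contributes a factor \<open>n\<close>, so the degree is the quantifier
  depth.\<close>

primrec cost :: "fm \<Rightarrow> nat poly" where
  "cost (Adj i j) = [:20:]"
| "cost (Eq i j) = [:20:]"
| "cost (Neg \<phi>) = cost \<phi> + [:10:]"
| "cost (Conj \<phi> \<psi>) = cost \<phi> + cost \<psi> + [:10:]"
| "cost (Exi \<phi>) = [:0, 1:] * (cost \<phi> + [:40:]) + [:40:]"

section \<open>Correctness and running time of compiled formulas\<close>

definition represents :: "nat \<Rightarrow> (nat \<Rightarrow> nat \<Rightarrow> bool) \<Rightarrow> nat \<Rightarrow> (nat \<Rightarrow> nat) \<Rightarrow> state \<Rightarrow> bool" where
  "represents n E d \<rho> s \<longleftrightarrow>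
     (\<forall>i<n. \<forall>j<n. s 1 (i * n + j) = of_bool (E i j)) \<and> s 2 0 = n \<and>
     (\<forall>i<d. \<rho> i < n \<and> s (3 * i + 3) 0 = \<rho> i \<and> s (3 * i + 4) 0 = \<rho> i * n)"

text \<open>Array 0 returns the result, and the arrays from \<open>3 * d + 3\<close> on belong to
  quantifiers at depth \<open>d\<close> or deeper.\<close>

definition agree :: "nat \<Rightarrow> state \<Rightarrow> state \<Rightarrow> bool" where
  "agree d s s' \<longleftrightarrow> (\<forall>a. 0 < a \<and> a < 3 * d + 3 \<longrightarrow> s' a = s a)"

definition computes :: "nat \<Rightarrow> (nat \<Rightarrow> nat \<Rightarrow> bool) \<Rightarrow> com \<Rightarrow> nat \<Rightarrow> (nat \<Rightarrow> nat) \<Rightarrow> bool \<Rightarrow> nat \<Rightarrow> bool"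
  where "computes n E c d \<rho> b T \<longleftrightarrow> (\<forall>s. represents n E d \<rho> s \<longrightarrow>
     (\<exists>t s'. exec c s t s' \<and> t \<le> T \<and> s' 0 0 = of_bool b \<and> agree d s s'))"

lemma computesD:
  assumes "computes n E c d \<rho> b T" "represents n E d \<rho> s"
  obtains t s' where "exec c s t s'" "t \<le> T" "s' 0 0 = of_bool b" "agree d s s'"
  using assms unfolding computes_def by blast

lemma represents_agree: "\<lbrakk>represents n E d \<rho> s; agree d s s'\<rbrakk> \<Longrightarrow> represents n E d \<rho> s'"
  unfolding represents_def agree_def by auto

lemma agree_trans: "\<lbrakk>agree d s s'; agree d s' s''\<rbrakk> \<Longrightarrow> agree d s s''"
  unfolding agree_def by auto

lemma agree_Suc: "agree (Suc d) s s' \<Longrightarrow> agree d s s'"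
  unfolding agree_def by auto

lemma exec_set_reg:
  "s' = s(a := (s a)(0 := exp_val e s)) \<Longrightarrow> t = 2 + exp_cost e \<Longrightarrow> exec (set_reg a e) s t s'"
  using exec.Assign[of a "Const 0" e s] by simp

lemma exec_While_exit:
  "exp_val e s = 0 \<Longrightarrow> t = 1 + exp_cost e \<Longrightarrow> exec (While e c) s t s"
  by (simp only: exec.WhileFalse)

text \<open>Induction on the number of remaining values; the flag records whether a witness below
  \<open>k\<close> exists. The 40 covers guard and updates of one round, the 6 is the final failing
  guard.\<close>

lemma exi_loop_exec:
  assumes body: "\<And>x. x < n \<Longrightarrow> computes n E c (Suc d) (\<rho>(d := x)) (P x) T"
    and "represents n E d \<rho> s" "k \<le> n" "s (3 * d + 3) 0 = k" "s (3 * d + 4) 0 = k * n"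
    and "s (3 * d + 5) 0 = of_bool (\<exists>x<k. P x)"
  shows "\<exists>t s'. exec (exi_loop c d) s t s' \<and> t \<le> (n - k) * (T + 40) + 6 \<and>
           s' (3 * d + 5) 0 = of_bool (\<exists>x<n. P x) \<and> agree d s s'"
  using assms(2-)
proof (induction "n - k" arbitrary: s k)
  case 0
  then have "k = n" by simp
  with 0 have "exec (exi_loop c d) s 6 s"
    by (intro exec_While_exit) (simp_all add: represents_def)
  moreover have "agree d s s"
    by (simp add: agree_def)
  ultimately show ?case
    using 0 \<open>k = n\<close> by (intro exI[of _ 6] exI[of _ s]) simp
next
  case (Suc m)
  then have k: "k < n" by simp
  let ?cond = "Cond (reg 0) (set_reg (3 * d + 5) (Const 1)) Skip"
  let ?inc = "set_reg (3 * d + 3) (Plus (reg (3 * d + 3)) (Const 1))"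
  let ?row = "set_reg (3 * d + 4) (Plus (reg (3 * d + 4)) (reg 2))"
  \<comment> \<open>The loop counter is itself the register of variable \<open>d\<close>.\<close>
  have "represents n E (Suc d) (\<rho>(d := k)) s"
    using Suc.prems k unfolding represents_def by (auto simp: less_Suc_eq)
  then obtain t1 s1 where s1: "exec c s t1 s1" "t1 \<le> T" "s1 0 0 = of_bool (P k)" "agree (Suc d) s s1"
    by (rule computesD[OF body[OF k]])
  \<comment> \<open>\<open>agree (Suc d)\<close> protects array \<open>3 * d + 5\<close> as well, so
    evaluating the body keeps the flag.\<close>
  have s1_regs: "s1 2 0 = n" "s1 (3 * d + 3) 0 = k" "s1 (3 * d + 4) 0 = k * n"
      "s1 (3 * d + 5) 0 = of_bool (\<exists>x<k. P x)"
    using s1(4) Suc.prems unfolding agree_def represents_def by auto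
  define s2 where "s2 = (if P k then s1(3 * d + 5 := (s1 (3 * d + 5))(0 := 1)) else s1)"
  obtain t2 where t2: "exec ?cond s1 t2 s2" "t2 \<le> 10"
  proof (cases "P k")
    case True
    then have "exec ?cond s1 (1 + exp_cost (reg 0) + 3) s2"
      using s1(3) unfolding s2_def by (intro exec.CondTrue exec_set_reg) auto
    with that show ?thesis by simp
  next
    case False
    then have "exec ?cond s1 (1 + exp_cost (reg 0) + 1) s2"
      using s1(3) exec.CondFalse[of "reg 0" s1, OF _ exec.Skip] unfolding s2_def by simp
    with that show ?thesis by simp
  qed
  define s3 where "s3 = s2(3 * d + 3 := (s2 (3 * d + 3))(0 := Suc k))"
  have s3: "exec ?inc s2 6 s3"
    using s1_regs unfolding s3_def s2_def by (intro exec_set_reg) auto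
  define s4 where "s4 = s3(3 * d + 4 := (s3 (3 * d + 4))(0 := Suc k * n))"
  have s4: "exec ?row s3 7 s4"
    using s1_regs unfolding s4_def s3_def s2_def
    by (intro exec_set_reg) (simp_all add: add.commute)
  have ag: "agree d s s4"
    using agree_Suc[OF s1(4)] unfolding agree_def s4_def s3_def s2_def by auto
  have regs: "s4 (3 * d + 3) 0 = Suc k" "s4 (3 * d + 4) 0 = Suc k * n"
      "s4 (3 * d + 5) 0 = of_bool (\<exists>x<Suc k. P x)"
    using s1_regs unfolding s4_def s3_def s2_def by (auto simp: less_Suc_eq)
  have "m = n - Suc k" "Suc k \<le> n"
    using Suc.hyps(2) by auto
  from Suc.hyps(1)[OF this(1) represents_agree[OF Suc.prems(1) ag] this(2) regs]
  obtain t5 s5 where s5: "exec (exi_loop c d) s4 t5 s5" "t5 \<le> (n - Suc k) * (T + 40) + 6"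
    "s5 (3 * d + 5) 0 = of_bool (\<exists>x<n. P x)" "agree d s4 s5"
    by blast
  have "exec (exi_body c d) s (t1 + (t2 + (6 + 7))) s4"
    by (intro exec.Seq) (fact s1 t2 s3 s4)+
  then have "exec (exi_loop c d) s (1 + exp_cost (Minus (reg 2) (reg (3 * d + 3))) + (t1 + (t2 + (6 + 7))) + t5) s5"
    using s5(1) k Suc.prems unfolding represents_def by (intro exec.WhileTrue) auto
  moreover have "1 + exp_cost (Minus (reg 2) (reg (3 * d + 3))) + (t1 + (t2 + (6 + 7))) + t5
      \<le> (n - k) * (T + 40) + 6"
  proof -
    have "n - k = Suc (n - Suc k)"
      using k by simp
    then show ?thesis
      using s1(2) t2(2) s5(2) by simp
  qed
  ultimately show ?case
    using s5(3) agree_trans[OF ag s5(4)] by blast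
qed

text \<open>Depth and assignment are generalised in the induction, since the body of a quantifier
  runs at depth \<open>Suc d\<close> under \<open>\<rho>(d := x)\<close>.\<close>

lemma compile_computes:
  assumes "wf_fm \<phi> d"
  shows "computes n E (compile \<phi> d) d \<rho> (sat n E \<phi> d \<rho>) (poly (cost \<phi>) n)"
  using assms
proof (induction \<phi> arbitrary: d \<rho>)
  case (Adj i j)
  show ?case
    unfolding computes_def
  proof (intro allI impI)
    fix s
    assume s: "represents n E d \<rho> s"
    let ?s' = "s(0 := (s 0)(0 := of_bool (E (\<rho> i) (\<rho> j))))"
    have "exec (compile (Adj i j) d) s 8 ?s'"
      unfolding compile.simps
      by (rule exec_set_reg) (use s Adj in \<open>simp_all add: represents_def\<close>)
    then show "\<exists>t s'. exec (compile (Adj i j) d) s t s' \<and> t \<le> poly (cost (Adj i j)) n \<and>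
        s' 0 0 = of_bool (sat n E (Adj i j) d \<rho>) \<and> agree d s s'"
      by (intro exI[of _ 8] exI[of _ ?s']) (simp add: agree_def)
  qed
next
  case (Eq i j)
  show ?case
    unfolding computes_def
  proof (intro allI impI)
    fix s
    assume s: "represents n E d \<rho> s"
    let ?s' = "s(0 := (s 0)(0 := of_bool (\<rho> i = \<rho> j)))"
    have "exec (compile (Eq i j) d) s 15 ?s'"
      unfolding compile.simps
      by (rule exec_set_reg) (use s Eq in \<open>auto simp: represents_def\<close>)
    then show "\<exists>t s'. exec (compile (Eq i j) d) s t s' \<and> t \<le> poly (cost (Eq i j)) n \<and>
        s' 0 0 = of_bool (sat n E (Eq i j) d \<rho>) \<and> agree d s s'"
      by (intro exI[of _ 15] exI[of _ ?s']) (simp add: agree_def)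
  qed
next
  case (Neg \<phi>)
  show ?case
    unfolding computes_def
  proof (intro allI impI)
    fix s
    assume "represents n E d \<rho> s"
    then obtain t s' where s': "exec (compile \<phi> d) s t s'" "t \<le> poly (cost \<phi>) n"
      "s' 0 0 = of_bool (sat n E \<phi> d \<rho>)" "agree d s s'"
      using computesD Neg by (metis wf_fm.simps(3))
    let ?s'' = "s'(0 := (s' 0)(0 := 1 - s' 0 0))"
    have "exec (set_reg 0 (Minus (Const 1) (reg 0))) s' 6 ?s''"
      by (rule exec_set_reg) simp_all
    then have "exec (compile (Neg \<phi>) d) s (t + 6) ?s''"
      unfolding compile.simps by (rule exec.Seq[OF s'(1)])
    then show "\<exists>t s'. exec (compile (Neg \<phi>) d) s t s' \<and> t \<le> poly (cost (Neg \<phi>)) n \<and>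
        s' 0 0 = of_bool (sat n E (Neg \<phi>) d \<rho>) \<and> agree d s s'"
      using s' by (intro exI[of _ "t + 6"] exI[of _ ?s'']) (auto simp: agree_def)
  qed
next
  case (Conj \<phi> \<psi>)
  show ?case
    unfolding computes_def
  proof (intro allI impI)
    fix s
    assume s: "represents n E d \<rho> s"
    then obtain t s' where s': "exec (compile \<phi> d) s t s'" "t \<le> poly (cost \<phi>) n"
      "s' 0 0 = of_bool (sat n E \<phi> d \<rho>)" "agree d s s'"
      using computesD Conj by (metis wf_fm.simps(4))
    then have "represents n E d \<rho> s'"
      using s represents_agree by blast
    then obtain u s'' where s'': "exec (compile \<psi> d) s' u s''" "u \<le> poly (cost \<psi>) n"
      "s'' 0 0 = of_bool (sat n E \<psi> d \<rho>)" "agree d s' s''"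
      using computesD Conj by (metis wf_fm.simps(4))
    show "\<exists>t s'. exec (compile (Conj \<phi> \<psi>) d) s t s' \<and> t \<le> poly (cost (Conj \<phi> \<psi>)) n \<and>
        s' 0 0 = of_bool (sat n E (Conj \<phi> \<psi>) d \<rho>) \<and> agree d s s'"
    proof (cases "sat n E \<phi> d \<rho>")
      case True
      then have "exec (compile (Conj \<phi> \<psi>) d) s (t + (1 + exp_cost (reg 0) + u)) s''"
        unfolding compile.simps using s'(3)
        by (intro exec.Seq[OF s'(1)] exec.CondTrue[OF _ s''(1)]) simp
      then show ?thesis
        using s' s'' True agree_trans[OF s'(4) s''(4)]
        by (intro exI[of _ "t + (1 + exp_cost (reg 0) + u)"] exI[of _ s'']) simp
    next
      case False
      then have "exec (compile (Conj \<phi> \<psi>) d) s (t + (1 + exp_cost (reg 0) + 1)) s'"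
        unfolding compile.simps using s'(3)
        by (intro exec.Seq[OF s'(1)] exec.CondFalse exec.Skip) simp
      then show ?thesis
        using s' False by (intro exI[of _ "t + (1 + exp_cost (reg 0) + 1)"] exI[of _ s']) simp
    qed
  qed
next
  case (Exi \<phi>)
  show ?case
    unfolding computes_def
  proof (intro allI impI)
    fix s
    assume s: "represents n E d \<rho> s"
    define s1 where "s1 = s(3 * d + 3 := (s (3 * d + 3))(0 := 0))"
    define s2 where "s2 = s1(3 * d + 4 := (s1 (3 * d + 4))(0 := 0))"
    define s3 where "s3 = s2(3 * d + 5 := (s2 (3 * d + 5))(0 := 0))"
    have ex1: "exec (set_reg (3 * d + 3) (Const 0)) s 3 s1"
      unfolding s1_def by (intro exec_set_reg) auto
    have ex2: "exec (set_reg (3 * d + 4) (Const 0)) s1 3 s2"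
      unfolding s2_def by (intro exec_set_reg) auto
    have ex3: "exec (set_reg (3 * d + 5) (Const 0)) s2 3 s3"
      unfolding s3_def by (intro exec_set_reg) auto
    have ag: "agree d s s3"
      unfolding agree_def s3_def s2_def s1_def by auto
    have "\<exists>t s'. exec (exi_loop (compile \<phi> (Suc d)) d) s3 t s' \<and>
        t \<le> (n - 0) * (poly (cost \<phi>) n + 40) + 6 \<and>
        s' (3 * d + 5) 0 = of_bool (\<exists>x<n. sat n E \<phi> (Suc d) (\<rho>(d := x))) \<and> agree d s3 s'"
      by (rule exi_loop_exec)
        (use Exi represents_agree[OF s ag] in \<open>auto simp: s3_def s2_def s1_def\<close>)
    then obtain t s4 where s4: "exec (exi_loop (compile \<phi> (Suc d)) d) s3 t s4"
      "t \<le> n * (poly (cost \<phi>) n + 40) + 6"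
      "s4 (3 * d + 5) 0 = of_bool (\<exists>x<n. sat n E \<phi> (Suc d) (\<rho>(d := x)))" "agree d s3 s4"
      by auto
    define s5 where "s5 = s4(0 := (s4 0)(0 := s4 (3 * d + 5) 0))"
    have ex5: "exec (set_reg 0 (reg (3 * d + 5))) s4 4 s5"
      unfolding s5_def by (intro exec_set_reg) auto
    have "exec (compile (Exi \<phi>) d) s (3 + (3 + (3 + (t + 4)))) s5"
      unfolding compile.simps by (intro exec.Seq) (fact ex1 ex2 ex3 s4(1) ex5)+
    moreover have "3 + (3 + (3 + (t + 4))) \<le> poly (cost (Exi \<phi>)) n"
      using s4(2) by simp
    moreover have "agree d s s5"
      using agree_trans[OF ag s4(4)] unfolding agree_def s5_def by auto
    ultimately show "\<exists>t s'. exec (compile (Exi \<phi>) d) s t s' \<and> t \<le> poly (cost (Exi \<phi>)) n \<and>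
        s' 0 0 = of_bool (sat n E (Exi \<phi>) d \<rho>) \<and> agree d s s'"
      using s4(3) by (intro exI[of _ "3 + (3 + (3 + (t + 4)))"] exI[of _ s5]) (simp add: s5_def)
  qed
qed

section \<open>Decoding of the adjacency matrix\<close>

lemma length_concat_rows: "length (concat (map (\<lambda>i. map (f i) [0..<n]) [0..<m])) = m * n"
  by (induction m) auto

lemma nth_concat_rows:
  "\<lbrakk>i < m; j < n\<rbrakk> \<Longrightarrow> concat (map (\<lambda>i. map (f i) [0..<n]) [0..<m]) ! (i * n + j) = f i j"
proof (induction m)
  case (Suc m)
  show ?case
  proof (cases "i = m")
    case True
    then show ?thesis
      using Suc.prems by (simp add: nth_append length_concat_rows)
  next
    case False
    then have "i < m" using Suc.prems by simp
    have "i * n + j < Suc i * n" using Suc.prems by simp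
    also have "\<dots> \<le> m * n" using \<open>i < m\<close> by (intro mult_le_mono1) simp
    finally show ?thesis
      using Suc \<open>i < m\<close> by (simp add: nth_append length_concat_rows)
  qed
qed simp

lemma length_adjacency_matrix: "length (adjacency_matrix G) = card (verts G) * card (verts G)"
  unfolding adjacency_matrix_def using length_concat_rows by (metis (no_types))

lemma nth_adjacency_matrix:
  assumes "i < card (verts G)" "j < card (verts G)"
  shows "adjacency_matrix G ! (i * card (verts G) + j) \<longleftrightarrow> {i, j} \<in> edges G"
  unfolding adjacency_matrix_def
  using nth_concat_rows[OF assms, of "\<lambda>i j. {i, j} \<in> edges G"] by simp

text \<open>The square root of the input length, by summing odd numbers in register 3.\<close>

definition sqrt_loop :: com where
  "sqrt_loop = While (Minus (reg 0) (reg 3))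
     (Seq (set_reg 3 (Plus (Plus (reg 3) (Const 1)) (Plus (reg 2) (reg 2))))
       (set_reg 2 (Plus (reg 2) (Const 1))))"

text \<open>By \<open>(k + 1)^2 = k^2 + 1 + 2k\<close>, register 3 remains the square of register 2
  until it reaches the input length.\<close>

lemma sqrt_loop_exec:
  assumes "k \<le> n" "s 0 0 = n * n" "s 2 0 = k" "s 3 0 = k * k"
  shows "\<exists>t s'. exec sqrt_loop s t s' \<and> t \<le> (n - k) * 40 + 6 \<and> s' 1 = s 1 \<and> s' 2 0 = n"
  using assms
proof (induction "n - k" arbitrary: s k)
  case 0
  then have "exec sqrt_loop s 6 s"
    unfolding sqrt_loop_def by (intro exec_While_exit) simp_all
  with 0 show ?case by auto
next
  case (Suc m)
  then have k: "k < n" by simp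
  define s1 where "s1 = s(3 := (s 3)(0 := Suc k * Suc k))"
  define s2 where "s2 = s1(2 := (s1 2)(0 := Suc k))"
  have e1: "exec (set_reg 3 (Plus (Plus (reg 3) (Const 1)) (Plus (reg 2) (reg 2)))) s 12 s1"
    using Suc.prems unfolding s1_def by (intro exec_set_reg) (simp_all add: algebra_simps)
  have e2: "exec (set_reg 2 (Plus (reg 2) (Const 1))) s1 6 s2"
    using Suc.prems unfolding s1_def s2_def by (intro exec_set_reg) auto
  have "m = n - Suc k" "Suc k \<le> n"
    using Suc.hyps(2) by auto
  moreover have "s2 0 0 = n * n" "s2 2 0 = Suc k" "s2 3 0 = Suc k * Suc k" "s2 1 = s 1"
    using Suc.prems unfolding s1_def s2_def by auto
  ultimately obtain t s' where s': "exec sqrt_loop s2 t s'" "t \<le> (n - Suc k) * 40 + 6" "s' 1 = s 1" "s' 2 0 = n"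
    using Suc.hyps(1)[of "Suc k" s2] by auto
  have "k * k < n * n"
    using k by (intro mult_strict_mono) auto
  then have "exec sqrt_loop s (1 + exp_cost (Minus (reg 0) (reg 3)) + (12 + 6) + t) s'"
    using s'(1) e1 e2 Suc.prems unfolding sqrt_loop_def
    by (intro exec.WhileTrue exec.Seq) auto
  moreover have "1 + exp_cost (Minus (reg 0) (reg 3)) + (12 + 6) + t \<le> (n - k) * 40 + 6"
  proof -
    have "n - k = Suc (n - Suc k)"
      using k by simp
    then show ?thesis
      using s'(2) by simp
  qed
  ultimately show ?case
    using s'(3,4) by blast
qed

text \<open>All coefficients are nonnegative. Thus a bound in \<open>n\<close> is also one in the
  input length \<open>n * n\<close>.\<close>

lemma poly_nat_mono: "x \<le> y \<Longrightarrow> poly (p :: nat poly) x \<le> poly p y"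
  by (induction p) (auto intro!: add_mono mult_mono)

text \<open>The program recovers \<open>n\<close> from the input length and then evaluates the
  closed formula from the empty assignment.\<close>

theorem first_order_poly_time:
  assumes "wf_fm \<phi> 0" and "X \<subseteq> graph_instances"
    and "\<And>G. G \<in> X \<Longrightarrow>
      P G \<longleftrightarrow> sat (card (verts G)) (\<lambda>x y. {x, y} \<in> edges G) \<phi> 0 (\<lambda>_. 0)"
  shows "poly_time_solvable_on adjacency_matrix X P"
proof -
  let ?c = "Seq sqrt_loop (compile \<phi> 0)" and ?p = "[:6, 40:] + cost \<phi>"
  have "\<exists>t s. exec ?c (input_state (adjacency_matrix G)) t s \<and>
      t \<le> poly ?p (length (adjacency_matrix G)) \<and> s 0 0 = (if P G then 1 else 0)"
    if "G \<in> X" for G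
  proof -
    let ?n = "card (verts G)" and ?E = "\<lambda>x y. {x, y} \<in> edges G"
    let ?s = "input_state (adjacency_matrix G)"
    have "?s 0 0 = ?n * ?n" "?s 2 0 = 0" "?s 3 0 = 0 * 0"
      by (simp_all add: input_state_def length_adjacency_matrix)
    then obtain t s where s: "exec sqrt_loop ?s t s" "t \<le> (?n - 0) * 40 + 6" "s 1 = ?s 1" "s 2 0 = ?n"
      using sqrt_loop_exec[of 0 ?n ?s] by blast
    have "s 1 (i * ?n + j) = of_bool (?E i j)" if "i < ?n" "j < ?n" for i j
    proof -
      have "i * ?n + j < Suc i * ?n" using that by simp
      also have "\<dots> \<le> ?n * ?n" using that by (intro mult_le_mono1) simp
      finally show ?thesis
        using that unfolding s(3) input_state_def
        by (simp add: length_adjacency_matrix nth_adjacency_matrix)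
    qed
    then have "represents ?n ?E 0 (\<lambda>_. 0) s"
      using s(4) unfolding represents_def by simp
    then obtain u s' where s': "exec (compile \<phi> 0) s u s'" "u \<le> poly (cost \<phi>) ?n"
      "s' 0 0 = of_bool (sat ?n ?E \<phi> 0 (\<lambda>_. 0))"
      by (rule computesD[OF compile_computes[OF assms(1)]])
    have "t + u \<le> poly ?p ?n"
      using s(2) s'(2) by simp
    also have "\<dots> \<le> poly ?p (length (adjacency_matrix G))"
      by (intro poly_nat_mono) (simp add: length_adjacency_matrix)
    finally show ?thesis
      using exec.Seq[OF s(1) s'(1)] s'(3) assms(3)[OF that] by (intro exI[of _ "t + u"] exI[of _ s']) simp
  qed
  then show ?thesis
    unfolding poly_time_solvable_on_def by (intro exI[of _ ?c] exI[of _ ?p]) blast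
qed

section \<open>A first-order formula for matching cuts\<close>

abbreviation Disj :: "fm \<Rightarrow> fm \<Rightarrow> fm" where
  "Disj \<phi> \<psi> \<equiv> Neg (Conj (Neg \<phi>) (Neg \<psi>))"

abbreviation Xor :: "fm \<Rightarrow> fm \<Rightarrow> fm" where
  "Xor \<phi> \<psi> \<equiv> Disj (Conj \<phi> (Neg \<psi>)) (Conj (Neg \<phi>) \<psi>)"

definition side_fm :: "nat \<Rightarrow> nat \<Rightarrow> nat \<Rightarrow> fm" where
  "side_fm u v w = Disj (Eq w u) (Conj (Adj w u) (Neg (Eq w v)))"

text \<open>\<open>d\<close> is the depth at which the formula is placed, so its own quantifiers
  bind \<open>d\<close> and \<open>Suc d\<close>.\<close>

definition blue_fm :: "nat \<Rightarrow> nat \<Rightarrow> nat \<Rightarrow> nat \<Rightarrow> nat \<Rightarrow> fm" where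
  "blue_fm d u v x w = Disj (side_fm v u w) (Conj (Neg (side_fm u v w))
     (Disj (Exi (Exi (Conj (Neg (Eq d (Suc d))) (Conj (Adj w d) (Conj (Adj w (Suc d))
        (Conj (side_fm v u d) (side_fm v u (Suc d))))))))
     (Disj (Neg (Exi (Conj (Adj w d) (side_fm u v d))))
     (Disj (Exi (Exi (Conj (Adj w d) (Conj (side_fm v u d) (Conj (Adj d (Suc d)) (side_fm u v (Suc d)))))))
       (Eq w x)))))"

text \<open>Variables 0, 1, 2 are \<open>u\<close>, \<open>v\<close>, \<open>x\<close>. Variable 3
  is first a neighbour of \<open>x\<close>; then 3, 4, 5 are a vertex and two neighbours violating
  \<open>cut_colouring\<close>, which puts \<open>blue_fm\<close> at depth 6.\<close>

definition matching_cut_fm :: fm where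
  "matching_cut_fm = Exi (Exi (Exi (Conj (Adj 0 1) (Conj (Exi (Adj 2 3)) (Neg (Exi (Exi (Exi
     (Conj (Adj 3 4) (Conj (Adj 3 5) (Conj (Xor (blue_fm 6 0 1 2 4) (blue_fm 6 0 1 2 3))
       (Conj (Xor (blue_fm 6 0 1 2 5) (blue_fm 6 0 1 2 3)) (Neg (Eq 4 5))))))))))))))"

lemma sat_side_fm [simp]: "sat n E (side_fm u v w) d \<rho> \<longleftrightarrow> side E (\<rho> u) (\<rho> v) (\<rho> w)"
  unfolding side_fm_def side_def by simp

text \<open>Each vertex quantified in \<open>blue\<close> is an end of an edge, so bounding it by
  \<open>n\<close> loses nothing. Free variables below \<open>d\<close> are not rebound.\<close>

lemma sat_blue_fm:
  assumes E: "\<And>x y. E x y \<Longrightarrow> x < n \<and> y < n" and "u < d" "v < d" "x < d" "w < d"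
  shows "sat n E (blue_fm d u v x w) d \<rho> \<longleftrightarrow> blue E (\<rho> u) (\<rho> v) (\<rho> x) (\<rho> w)"
proof -
  have E': "x < n" "y < n" if "E x y" for x y
    using E[OF that] by auto
  have 1: "sat n E (Exi (Exi (Conj (Neg (Eq d (Suc d))) (Conj (Adj w d) (Conj (Adj w (Suc d))
        (Conj (side_fm v u d) (side_fm v u (Suc d)))))))) d \<rho> \<longleftrightarrow>
      (\<exists>y z. y \<noteq> z \<and> E (\<rho> w) y \<and> E (\<rho> w) z \<and> side E (\<rho> v) (\<rho> u) y \<and> side E (\<rho> v) (\<rho> u) z)"
    using assms(2-) by simp (blast dest: E')
  have 2: "sat n E (Exi (Conj (Adj w d) (side_fm u v d))) d \<rho> \<longleftrightarrow>
      (\<exists>y. E (\<rho> w) y \<and> side E (\<rho> u) (\<rho> v) y)"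
    using assms(2-) by simp (blast dest: E')
  have 3: "sat n E (Exi (Exi (Conj (Adj w d) (Conj (side_fm v u d) (Conj (Adj d (Suc d))
        (side_fm u v (Suc d))))))) d \<rho> \<longleftrightarrow>
      (\<exists>y z. E (\<rho> w) y \<and> side E (\<rho> v) (\<rho> u) y \<and> E y z \<and> side E (\<rho> u) (\<rho> v) z)"
    using assms(2-) by simp (blast dest: E')
  show ?thesis
    by (simp only: blue_fm_def blue_def sat.simps(2-4) sat_side_fm 1 2 3) blast
qed

lemma sat_matching_cut_fm:
  assumes E: "\<And>x y. E x y \<Longrightarrow> x < n \<and> y < n"
  shows "sat n E matching_cut_fm 0 \<rho> \<longleftrightarrow>
    (\<exists>u v x. E u v \<and> (\<exists>y. E x y) \<and> cut_colouring E (blue E u v x))"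
proof -
  have E': "x < n" "y < n" if "E x y" for x y
    using E[OF that] by auto
  \<comment> \<open>The colour inequalities take the shape in which \<open>Xor\<close> expresses
    them.\<close>
  have cut: "cut_colouring E B \<longleftrightarrow> \<not> (\<exists>w<n. \<exists>y<n. \<exists>z<n. E w y \<and> E w z \<and>
      (B y \<and> \<not> B w \<or> \<not> B y \<and> B w) \<and> (B z \<and> \<not> B w \<or> \<not> B z \<and> B w) \<and> y \<noteq> z)" for B
    unfolding cut_colouring_def by (blast dest: E')
  have blue: "sat n E (blue_fm 6 0 (Suc 0) 2 w) d \<rho> \<longleftrightarrow> blue E (\<rho> 0) (\<rho> (Suc 0)) (\<rho> 2) (\<rho> w)"
    if "d = 6" "w < 6" for d w \<rho>
    unfolding that(1) using that(2) by (intro sat_blue_fm E) auto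
  have "sat n E matching_cut_fm 0 \<rho> \<longleftrightarrow> (\<exists>u<n. \<exists>v<n. \<exists>x<n. E u v \<and> (\<exists>y<n. E x y) \<and>
      cut_colouring E (blue E u v x))"
    unfolding matching_cut_fm_def cut by (simp add: blue)
  also have "\<dots> \<longleftrightarrow> (\<exists>u v x. E u v \<and> (\<exists>y. E x y) \<and> cut_colouring E (blue E u v x))"
    by (blast dest: E')
  finally show ?thesis .
qed

lemma wf_matching_cut_fm: "wf_fm matching_cut_fm 0"
  unfolding matching_cut_fm_def blue_fm_def side_fm_def by simp

theorem theorem1:
  "poly_time_solvable_on adjacency_matrix
     {G \<in> graph_instances. connected_graph G \<and> path_free 5 G}
     has_matching_cut"
proof (rule first_order_poly_time[OF wf_matching_cut_fm])
  fix G :: "nat graph"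
  assume "G \<in> {G \<in> graph_instances. connected_graph G \<and> path_free 5 G}"
  then obtain n where G: "simple_graph G" "connected_graph G" "path_free 5 G" and n: "verts G = {..<n}"
    unfolding graph_instances_def by blast
  let ?E = "\<lambda>x y. {x, y} \<in> edges G"
  \<comment> \<open>The vertices are the numbers below their cardinality, which is the range of the
    bounded quantifiers.\<close>
  have "x < card (verts G) \<and> y < card (verts G)" if "?E x y" for x y
    using that G(1) unfolding simple_graph_def n by auto
  then show "has_matching_cut G \<longleftrightarrow> sat (card (verts G)) ?E matching_cut_fm 0 (\<lambda>_. 0)"
    using has_matching_cut_iff_colouring[OF G(1,2)]
      P5_free_adjacency.ex_cut_colouring_iff_blue[OF path_free_5_no_P5[OF G(1,3)]]
      sat_matching_cut_fm[of ?E] by simp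
qed auto

end
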